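(* Let $r$ be an ab-ba rotor type satisfying: (i) $|r|\equiv 0\pmod 4$; (ii) for any two $21$ blocks of $r$ that are the $a$-th and $b$-th blocks of $r$, it is not the case that $\lceil a/2\rceil\equiv b\pmod{|r|}$; (iii) for every pair of $21$ blocks of $r$, their positions as blocks have the same parity. Then $r$ is universal.
   Context: A rotor type is an infinite periodic sequence $r=(r^{(1)},r^{(2)},\dots)$ of natural numbers (states), with fundamental period $|r|$; two rotor types are equivalent if one is obtained from the other by an injective relabeling of states. A two-state rotor type is written over $\{1,2\}$ with $r^{(1)}=1$; it is ab-ba if $|r|$ is even and for every $k\ge0$ the pair $(r^{(2k+1)},r^{(2k+2)})$, called the $(k+1)$-th block of $r$, is $12$ or $21$. A rotor-router network consists of a finite digraph (loops and multiple edges allowed), a source vertex, a set of target vertices of outdegree $0$ such that every non-target vertex can reach a target, and at each non-target vertex $v$ a periodic sequence $e_v^{(1)},e_v^{(2)},\dots$ of out-edges; a particle starts at the source, on its $n$-th visit to a non-target vertex $v$ leaves along $e_v^{(n)}$, and whenever it reaches a target it is returned to the source. The hitting sequence is the (periodic) sequence of targets reached. A network is homogeneous of type $r$ if at every non-target vertex $v$, $e_v^{(n)}=\phi_v(r^{(n)})$ for some injective map $\phi_v$ from states of $r$ to out-edges of $v$. A rotor type $r$ models $r'$ if some homogeneous network of type $r$ has hitting sequence (targets regarded as states) equivalent to $r'$; $r$ is universal if it models every rotor type. *)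

theory Defs
  imports Complex_Main "HOL-Number_Theory.Cong" "Graph_Theory.Digraph"
begin

text \<open>
  All sequences are indexed from 0, so \<open>r n\<close> is the mathematical $r^{(n+1)}$.
  Block positions, however, are counted from 1.
\<close>

definition periodic :: "(nat \<Rightarrow> 'a) \<Rightarrow> bool" where
  "periodic f \<longleftrightarrow> (\<exists>p>0. \<forall>n. f (n + p) = f n)"

definition fundamental_period :: "(nat \<Rightarrow> 'a) \<Rightarrow> nat" where
  "fundamental_period f = (LEAST p. p > 0 \<and> (\<forall>n. f (n + p) = f n))"

definition rotor_type :: "(nat \<Rightarrow> nat) \<Rightarrow> bool" where
  "rotor_type r \<longleftrightarrow> periodic r"

definition rotor_equivalent :: "(nat \<Rightarrow> nat) \<Rightarrow> (nat \<Rightarrow> nat) \<Rightarrow> bool" where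
  "rotor_equivalent r r' \<longleftrightarrow> (\<exists>f. inj_on f (range r) \<and> (\<forall>n. r' n = f (r n)))"

definition two_state :: "(nat \<Rightarrow> nat) \<Rightarrow> bool" where
  "two_state r \<longleftrightarrow> rotor_type r \<and> range r = {1, 2} \<and> r 0 = 1"

text \<open>The \<open>k\<close>-th block $(r^{(2k-1)}, r^{(2k)})$, meaningful for \<open>k \<ge> 1\<close> only.\<close>

definition block :: "(nat \<Rightarrow> nat) \<Rightarrow> nat \<Rightarrow> nat \<times> nat" where
  "block r k = (r (2 * k - 2), r (2 * k - 1))"

definition abba :: "(nat \<Rightarrow> nat) \<Rightarrow> bool" where
  "abba r \<longleftrightarrow> two_state r \<and> even (fundamental_period r) \<and>
     (\<forall>k\<ge>1. block r k = (1, 2) \<or> block r k = (2, 1))"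

text \<open>
  Positions run over the whole infinite sequence, not just over one period.
\<close>

definition block21_positions :: "(nat \<Rightarrow> nat) \<Rightarrow> nat set" where
  "block21_positions r = {k. k \<ge> 1 \<and> block r k = (2, 1)}"

text \<open>
  \<open>rot v n\<close> is the out-edge used on the \<open>(n+1)\<close>-st visit to \<open>v\<close>; its values at target
  vertices are irrelevant.
\<close>

locale rotor_network = fin_digraph G
  for G :: "('v, 'e) pre_digraph" +
  fixes source :: 'v
    and targets :: "'v set"
    and rot :: "'v \<Rightarrow> nat \<Rightarrow> 'e"
  assumes source_in_verts: "source \<in> verts G"
    and targets_in_verts: "targets \<subseteq> verts G"
    and out_degree_target: "v \<in> targets \<Longrightarrow> out_degree G v = 0"
    and reaches_target: "v \<in> verts G - targets \<Longrightarrow> \<exists>t\<in>targets. v \<rightarrow>\<^sup>*\<^bsub>G\<^esub> t"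
    and rot_out_arcs: "v \<in> verts G - targets \<Longrightarrow> rot v n \<in> out_arcs G v"
    and rot_periodic: "v \<in> verts G - targets \<Longrightarrow> periodic (rot v)"

text \<open>
  The state after \<open>i\<close> moves: the position of the particle, and for each vertex the number of
  departures from it so far along its rotor. Returning from a target to the source counts as
  a move.
\<close>

primrec walk ::
  "('v, 'e) pre_digraph \<Rightarrow> 'v \<Rightarrow> 'v set \<Rightarrow> ('v \<Rightarrow> nat \<Rightarrow> 'e) \<Rightarrow> nat \<Rightarrow> 'v \<times> ('v \<Rightarrow> nat)" where
  "walk G s T rot 0 = (s, \<lambda>_. 0)"
| "walk G s T rot (Suc i) =
     (let (v, c) = walk G s T rot i
      in if v \<in> T then (s, c) else (head G (rot v (c v)), c(v := Suc (c v))))"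

definition position ::
  "('v, 'e) pre_digraph \<Rightarrow> 'v \<Rightarrow> 'v set \<Rightarrow> ('v \<Rightarrow> nat \<Rightarrow> 'e) \<Rightarrow> nat \<Rightarrow> 'v" where
  "position G s T rot i = fst (walk G s T rot i)"

text \<open>
  \<open>\<tau>\<close> enumerates the times at which the particle is at a target; in particular there must be
  infinitely many of them. This is not automatic: some out-edges of a vertex may not occur in
  its rotor, so that the particle might never get to a target.
\<close>

definition hitting_sequence ::
  "('v, 'e) pre_digraph \<Rightarrow> 'v \<Rightarrow> 'v set \<Rightarrow> ('v \<Rightarrow> nat \<Rightarrow> 'e) \<Rightarrow> (nat \<Rightarrow> 'v) \<Rightarrow> bool" where
  "hitting_sequence G s T rot h \<longleftrightarrow>
     (\<exists>\<tau>. strict_mono \<tau> \<and> range \<tau> = {i. position G s T rot i \<in> T} \<and>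
          (\<forall>n. h n = position G s T rot (\<tau> n)))"

definition homogeneous ::
  "(nat \<Rightarrow> nat) \<Rightarrow> ('v, 'e) pre_digraph \<Rightarrow> 'v set \<Rightarrow> ('v \<Rightarrow> nat \<Rightarrow> 'e) \<Rightarrow> bool" where
  "homogeneous r G T rot \<longleftrightarrow>
     (\<forall>v \<in> verts G - T. \<exists>\<phi>. inj_on \<phi> (range r) \<and> \<phi> ` range r \<subseteq> out_arcs G v \<and>
        (\<forall>n. rot v n = \<phi> (r n)))"

text \<open>
  Networks are finite, so taking vertices and edges to be natural numbers loses no generality;
  it also makes every hitting sequence a sequence of states.
\<close>

definition models :: "(nat \<Rightarrow> nat) \<Rightarrow> (nat \<Rightarrow> nat) \<Rightarrow> bool" where
  "models r r' \<longleftrightarrow>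
     (\<exists>(G :: (nat, nat) pre_digraph) s T rot h.
        rotor_network G s T rot \<and> homogeneous r G T rot \<and>
        hitting_sequence G s T rot h \<and> rotor_equivalent h r')"

definition universal :: "(nat \<Rightarrow> nat) \<Rightarrow> bool" where
  "universal r \<longleftrightarrow> (\<forall>r'. rotor_type r' \<longrightarrow> models r r')"

end

theory Submission
  imports Defs "HOL-Library.Countable"
begin

text \<open>
  Number rotor states and blocks from 0, so that block \<open>k\<close> consists of \<open>r (2 * k)\<close> and
  \<open>r (2 * k + 1)\<close>. Conditions (ii) and (iii) yield a state \<open>\<sigma>\<close> such that \<open>r k = \<sigma>\<close> forces
  block \<open>k\<close> to be \<open>12\<close>: take \<open>\<sigma> = 2\<close> if the \<open>21\<close> blocks have even positions \<open>k\<close>, and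
  \<open>\<sigma> = 1\<close> otherwise. Now let a rotor \<open>U\<close> send the particle to \<open>X\<close> in state 1 and to \<open>Y\<close> in
  state 2, and let \<open>X\<close> and \<open>Y\<close> release it in state \<open>\<sigma>\<close> and return it to \<open>U\<close> otherwise. While
  \<open>U\<close> runs through block \<open>k\<close>, both \<open>X\<close> and \<open>Y\<close> are in state \<open>r k\<close>; hence the particle is
  released only during \<open>12\<close> blocks, first from \<open>X\<close> and then from \<open>Y\<close>. So the three rotors
  act as the rotor \<open>12\<close>.

  A complete binary tree of rotors \<open>12\<close> of depth \<open>k\<close> visits its \<open>2 ^ k\<close> leaves cyclically. If
  \<open>m\<close> is a period of \<open>r'\<close> and \<open>m \<le> 2 ^ k\<close>, identify leaf \<open>s < m\<close> with the target \<open>r' s\<close> and the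
  other leaves with the root: the hitting sequence becomes \<open>r'\<close>.
\<close>

section \<open>Networks given by a transition function\<close>

text \<open>Targets have no successor, so a run covers the moves up to a single hit; the return to
  the source is added in \<open>hitting_sequenceI\<close>.\<close>

definition step :: "'v set \<Rightarrow> ('v \<Rightarrow> 'a \<Rightarrow> 'v) \<Rightarrow> (nat \<Rightarrow> 'a) \<Rightarrow> 'v \<times> ('v \<Rightarrow> nat) \<Rightarrow> 'v \<times> ('v \<Rightarrow> nat) \<Rightarrow> bool" where
  "step T \<delta> r p q \<longleftrightarrow> fst p \<notin> T \<and>
     q = (\<delta> (fst p) (r (snd p (fst p))), (snd p)(fst p := Suc (snd p (fst p))))"

lemma period_mod:
  fixes f :: "nat \<Rightarrow> 'a"
  assumes "\<And>n. f (n + p) = f n"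
  shows "f (n mod p) = f n"
proof -
  have "f (n + j * p) = f n" for n j
  proof (induction j)
    case (Suc j)
    show ?case using assms[of "n + j * p"] Suc by (simp add: algebra_simps)
  qed simp
  from this[of "n mod p" "n div p"] show ?thesis by simp
qed

lemma periodic_finite_range:
  fixes f :: "nat \<Rightarrow> 'a"
  assumes "periodic f"
  shows "finite (range f)"
proof -
  obtain p where p: "p > 0" "\<And>n. f (n + p) = f n"
    using assms by (auto simp: periodic_def)
  have "f n \<in> f ` {..<p}" for n
    using period_mod[where f = f and p = p and n = n, OF p(2)] p(1) by (intro rev_image_eqI[of "n mod p"]) auto
  then have "range f \<subseteq> f ` {..<p}" by auto
  then show ?thesis by (rule finite_subset) simp
qed

text \<open>Each abstract step is one move of the walk under the embedding \<open>e\<close>, whose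
  injectivity keeps the other counts intact. The last conjunct excludes hits before time
  \<open>j\<close>.\<close>

lemma walk_step:
  assumes "(step T \<delta> r)\<^sup>*\<^sup>* (v, c) (w, d)"
    and "walk G s' T' rot i = (e v, c')" and "\<And>v. c' (e v) = c v"
    and "\<And>v. e v \<in> T' \<longleftrightarrow> v \<in> T" and "inj e"
    and head: "\<And>v n. head G (rot (e v) n) = e (\<delta> v (r n))"
  shows "\<exists>j\<ge>i. \<exists>d'. walk G s' T' rot j = (e w, d') \<and> (\<forall>v. d' (e v) = d v) \<and>
           (\<forall>l\<in>{i..<j}. position G s' T' rot l \<notin> T')"
  using assms(1)
proof (induction "(w, d)" arbitrary: w d rule: rtranclp_induct)
  case base
  then show ?case using assms(2,3) by auto
next
  case (step q)
  obtain x b where q: "q = (x, b)" by force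
  from step(3)[OF q] obtain j d' where j: "j \<ge> i" "walk G s' T' rot j = (e x, d')"
    "\<forall>v. d' (e v) = b v" "\<forall>l\<in>{i..<j}. position G s' T' rot l \<notin> T'" by blast
  have x: "x \<notin> T" "w = \<delta> x (r (b x))" "d = b(x := Suc (b x))"
    using step(2) by (auto simp: q step_def)
  have xT: "e x \<notin> T'" using x assms(4) by simp
  have 1: "walk G s' T' rot (Suc j) = (e w, d'(e x := Suc (d' (e x))))"
    using j(2,3) x xT head by simp
  have 2: "(d'(e x := Suc (d' (e x)))) (e v) = d v" for v
    using j(3) x(3) \<open>inj e\<close> by (auto simp: inj_eq)
  have 3: "position G s' T' rot l \<notin> T'" if "l \<in> {i..<Suc j}" for l
    using that j(2,4) xT by (cases "l = j") (auto simp: position_def)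
  show ?case using 1 2 3 j(1) by (intro exI[of _ "Suc j"]) auto
qed

text \<open>\<open>I n\<close> describes the counts when the particle sets out from \<open>s\<close>
  after \<open>n\<close> hits. Each instance of \<open>run\<close> is the stretch up to the next
  hit; dependent choice joins the stretches.\<close>

lemma hitting_sequenceI:
  fixes t :: "nat \<Rightarrow> 'v"
  assumes "\<And>v. e v \<in> T' \<longleftrightarrow> v \<in> T" and "inj e"
    and "\<And>v n. head G (rot (e v) n) = e (\<delta> v (r n))"
    and init: "I 0 (\<lambda>_. 0)"
    and run: "\<And>n c. I n c \<Longrightarrow> \<exists>c'. (step T \<delta> r)\<^sup>*\<^sup>* (s, c) (t n, c') \<and> I (Suc n) c'"
    and t: "\<And>n. t n \<in> T"
  shows "hitting_sequence G (e s) T' rot (\<lambda>n. e (t n))"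
proof -
  let ?pos = "position G (e s) T' rot"
  define Q where "Q n i \<longleftrightarrow> (\<exists>c c'. walk G (e s) T' rot i = (e (t n), c') \<and>
    (\<forall>v. c' (e v) = c v) \<and> I (Suc n) c)" for n i
  have next_hit: "\<exists>j\<ge>i. Q n j \<and> (\<forall>l\<in>{i..<j}. ?pos l \<notin> T')"
    if "walk G (e s) T' rot i = (e s, c')" "\<And>v. c' (e v) = c v" "I n c" for i n c c'
  proof -
    from run[OF that(3)] obtain d where d: "(step T \<delta> r)\<^sup>*\<^sup>* (s, c) (t n, d)" "I (Suc n) d"
      by blast
    from walk_step[OF d(1) that(1,2) assms(1-3)] d(2) show ?thesis
      unfolding Q_def by blast
  qed
  obtain i\<^sub>0 where i0: "Q 0 i\<^sub>0" "\<forall>l<i\<^sub>0. ?pos l \<notin> T'"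
    using next_hit[of 0 "\<lambda>_. 0" "\<lambda>_. 0" 0] init by auto
  \<comment> \<open>Pinning the initial choice to \<open>i\<^sub>0\<close> makes
    \<open>\<tau>\<close> start at the very first hit.\<close>
  define P where "P n i \<longleftrightarrow> Q n i \<and> (n = 0 \<longrightarrow> i = i\<^sub>0)" for n i
  have "\<exists>\<tau>. \<forall>n. P n (\<tau> n) \<and> (\<tau> n < \<tau> (Suc n) \<and> (\<forall>l\<in>{Suc (\<tau> n)..<\<tau> (Suc n)}. ?pos l \<notin> T'))"
  proof (rule dependent_nat_choice)
    show "\<exists>x. P 0 x" using i0 by (auto simp: P_def)
    fix i n assume "P n i"
    then obtain c c' where c: "walk G (e s) T' rot i = (e (t n), c')"
      "\<And>v. c' (e v) = c v" "I (Suc n) c" by (auto simp: P_def Q_def)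
    have "walk G (e s) T' rot (Suc i) = (e s, c')"
      using c(1) t assms(1) by simp
    from next_hit[OF this c(2,3)]
    show "\<exists>y. P (Suc n) y \<and> i < y \<and> (\<forall>l\<in>{Suc i..<y}. ?pos l \<notin> T')"
      by (auto simp: P_def Suc_le_eq)
  qed
  then obtain \<tau> where \<tau>: "\<And>n. P n (\<tau> n)" "\<And>n. \<tau> n < \<tau> (Suc n)"
    "\<And>n l. l \<in> {Suc (\<tau> n)..<\<tau> (Suc n)} \<Longrightarrow> ?pos l \<notin> T'" by blast
  have mono: "strict_mono \<tau>" using \<tau>(2) by (simp add: strict_mono_Suc_iff)
  have pos: "?pos (\<tau> n) = e (t n)" for n
    using \<tau>(1)[of n] by (auto simp: P_def Q_def position_def)
  have "i \<in> range \<tau>" if i: "?pos i \<in> T'" for i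
  proof -
    have "\<tau> 0 \<le> i" using \<tau>(1)[of 0] i i0 by (auto simp: P_def not_less[symmetric])
    moreover have "i < \<tau> (Suc i)"
      using strict_mono_imp_increasing[OF mono, of "Suc i"] by simp
    \<comment> \<open>The least \<open>n'\<close> with \<open>i < \<tau> n'\<close> traps
      \<open>i\<close> between two consecutive hits.\<close>
    ultimately have "\<exists>n\<le>Suc i. (\<forall>l<n. \<not> i < \<tau> l) \<and> i < \<tau> n"
      by (intro ex_least_nat_le)
    then obtain n' where n': "\<forall>l<n'. \<not> i < \<tau> l" "i < \<tau> n'" by blast
    with \<open>\<tau> 0 \<le> i\<close> obtain n where "n' = Suc n" by (cases n') auto
    with n' have "\<tau> n \<le> i" "i < \<tau> (Suc n)" by (simp_all add: not_less)
    then show ?thesis using \<tau>(3)[of i n] i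
      by (metis Suc_leI atLeastLessThan_iff le_neq_implies_less rangeI)
  qed
  moreover have "?pos (\<tau> n) \<in> T'" for n using pos t assms(1) by simp
  ultimately have "range \<tau> = {i. ?pos i \<in> T'}" by auto
  then show ?thesis unfolding hitting_sequence_def using mono pos by auto
qed

lemma modelsI:
  fixes \<delta> :: "'v::countable \<Rightarrow> nat \<Rightarrow> 'v" and t :: "nat \<Rightarrow> 'v"
  assumes r: "periodic r"
    and V: "finite V" "s \<in> V" "T \<subseteq> V" "\<And>v n. v \<in> V - T \<Longrightarrow> \<delta> v (r n) \<in> V"
    and reach: "\<And>v. v \<in> V \<Longrightarrow> \<exists>w\<in>T. (\<lambda>v w. v \<in> V - T \<and> (\<exists>n. w = \<delta> v (r n)))\<^sup>*\<^sup>* v w"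
    and init: "I 0 (\<lambda>_. 0)"
    and run: "\<And>n c. I n c \<Longrightarrow> \<exists>c'. (step T \<delta> r)\<^sup>*\<^sup>* (s, c) (t n, c') \<and> I (Suc n) c'"
    and t: "\<And>n. t n \<in> T"
    and f: "inj_on f (range t)" "\<And>n. r' n = f (t n)"
  shows "models r r'"
proof -
  let ?E = "(V - T) \<times> range r"
  \<comment> \<open>An arc encodes a vertex and a state, so different states give different arcs
    even if their heads coincide, as homogeneity demands.\<close>
  define G :: "(nat, nat) pre_digraph" where
    "G = \<lparr>verts = to_nat ` V, arcs = (\<lambda>(v, a). prod_encode (to_nat v, a)) ` ?E,
          tail = (\<lambda>x. fst (prod_decode x)),
          head = (\<lambda>x. case prod_decode x of (v, a) \<Rightarrow> to_nat (\<delta> (from_nat v) a))\<rparr>"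
  define rot where "rot v n = prod_encode (v, r n)" for v n
  let ?T = "to_nat ` T"
  have inT: "to_nat v \<in> ?T \<longleftrightarrow> v \<in> T" for v :: 'v by auto
  interpret fin_digraph G
    by unfold_locales (use V r in \<open>auto simp: G_def periodic_finite_range\<close>)
  have arc: "rot (to_nat v) n \<in> out_arcs G (to_nat v)" if "v \<in> V - T" for v n
    using that by (auto simp: rot_def G_def out_arcs_def)
  have head: "head G (rot (to_nat v) n) = to_nat (\<delta> v (r n))" for v n
    by (simp add: G_def rot_def)
  have reach_G: "to_nat v \<rightarrow>\<^sup>*\<^bsub>G\<^esub> to_nat w"
    if "(\<lambda>v w. v \<in> V - T \<and> (\<exists>n. w = \<delta> v (r n)))\<^sup>*\<^sup>* v w" "v \<in> V" for v w
    using that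
  proof (induction rule: rtranclp_induct)
    case base
    then show ?case by (simp add: reachable_in_verts G_def reachable_def rtrancl_on.intros)
  next
    case (step x y)
    then obtain n where n: "x \<in> V - T" "y = \<delta> x (r n)" by blast
    have "to_nat x \<rightarrow>\<^bsub>G\<^esub> to_nat y"
      using arc[OF n(1), of n] head[of x n] n(2)
      by (intro dominatesI[where a = "rot (to_nat x) n"]) (auto simp: arc_to_ends_def)
    then show ?case using step by (meson reachable_adj_trans)
  qed
  have net: "rotor_network G (to_nat s) ?T rot"
  proof unfold_locales
    show "to_nat s \<in> verts G" "?T \<subseteq> verts G" using V by (auto simp: G_def)
    show "out_degree G v = 0" if "v \<in> ?T" for v
    proof -
      have "out_arcs G v = {}" using that by (auto simp: out_arcs_def G_def)
      then show ?thesis by (simp add: out_degree_def)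
    qed
    fix v assume "v \<in> verts G - ?T"
    then obtain x where x: "v = to_nat x" "x \<in> V - T" by (auto simp: G_def)
    show "\<exists>t\<in>?T. v \<rightarrow>\<^sup>*\<^bsub>G\<^esub> t" using reach[of x] reach_G[of x] x by blast
    show "rot v n \<in> out_arcs G v" for n using arc x by simp
    show "periodic (rot v)" using r unfolding periodic_def rot_def by metis
  qed
  have hom: "homogeneous r G ?T rot"
    unfolding homogeneous_def
  proof
    fix v assume "v \<in> verts G - ?T"
    then obtain x where x: "v = to_nat x" "x \<in> V - T" by (auto simp: G_def)
    show "\<exists>\<phi>. inj_on \<phi> (range r) \<and> \<phi> ` range r \<subseteq> out_arcs G v \<and> (\<forall>n. rot v n = \<phi> (r n))"
      using arc[OF x(2)] x(1)
      by (intro exI[of _ "\<lambda>a. prod_encode (v, a)"]) (auto simp: inj_on_def rot_def)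
  qed
  have hit: "hitting_sequence G (to_nat s) ?T rot (\<lambda>n. to_nat (t n))"
    using hitting_sequenceI[where e = to_nat and I = I, OF inT inj_to_nat head init run t]
    by blast
  have "rotor_equivalent (\<lambda>n. to_nat (t n)) r'"
    unfolding rotor_equivalent_def using f
    by (intro exI[of _ "\<lambda>x. f (from_nat x)"]) (auto simp: inj_on_def)
  then show ?thesis unfolding models_def using net hom hit by blast
qed

section \<open>Binary trees of switches\<close>

datatype vertex = U nat nat | X nat nat | Y nat nat | Target nat

instance vertex :: countable
  by countable_datatype

text \<open>
  The node at depth \<open>d\<close> with index \<open>s < 2 ^ d\<close> is visited by those particles whose number is
  congruent to \<open>s\<close> modulo \<open>2 ^ d\<close>, so its children at depth \<open>d + 1\<close> are \<open>s\<close> and \<open>s + 2 ^ d\<close>.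
\<close>

definition node :: "(nat \<Rightarrow> nat) \<Rightarrow> nat \<Rightarrow> nat \<Rightarrow> nat \<Rightarrow> nat \<Rightarrow> vertex" where
  "node r' m k d s = (if d < k then U d s else if s < m then Target (r' s) else U 0 0)"

fun tree_edge :: "(nat \<Rightarrow> nat) \<Rightarrow> nat \<Rightarrow> nat \<Rightarrow> nat \<Rightarrow> vertex \<Rightarrow> nat \<Rightarrow> vertex" where
  "tree_edge r' m k \<sigma> (U d s) a = (if a = 1 then X d s else Y d s)"
| "tree_edge r' m k \<sigma> (X d s) a = (if a = \<sigma> then node r' m k (Suc d) s else U d s)"
| "tree_edge r' m k \<sigma> (Y d s) a = (if a = \<sigma> then node r' m k (Suc d) (s + 2 ^ d) else U d s)"
| "tree_edge r' m k \<sigma> (Target t) a = Target t"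

text \<open>
  \<open>b\<close> tells whether the next exit is through \<open>Y\<close>, in the middle of a block of \<open>U\<close>.
\<close>

definition switch :: "(nat \<Rightarrow> nat) \<Rightarrow> nat \<Rightarrow> (vertex \<Rightarrow> nat) \<Rightarrow> nat \<Rightarrow> nat \<Rightarrow> bool \<Rightarrow> bool" where
  "switch r \<sigma> c d s b \<longleftrightarrow> (\<exists>j. c (Y d s) = j \<and>
     (if b then c (U d s) = 2 * j + 1 \<and> c (X d s) = j + 1 \<and> r j = \<sigma>
      else c (U d s) = 2 * j \<and> c (X d s) = j))"

lemma switch_cong:
  assumes "switch r \<sigma> c d s b" "c' (U d s) = c (U d s)" "c' (X d s) = c (X d s)"
    "c' (Y d s) = c (Y d s)"
  shows "switch r \<sigma> c' d s b"
  using assms by (simp add: switch_def)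

text \<open>
  Number of the particles \<open>0, \<dots>, N - 1\<close> whose index is congruent to \<open>s < 2 ^ d\<close> modulo \<open>2 ^ d\<close>.
\<close>

definition visits :: "nat \<Rightarrow> nat \<Rightarrow> nat \<Rightarrow> nat" where
  "visits N d s = (N + 2 ^ d - 1 - s) div 2 ^ d"

lemma visits_0: "s < 2 ^ d \<Longrightarrow> visits 0 d s = 0"
  by (simp add: visits_def)

text \<open>\<open>visits N d s\<close> is the ceiling of \<open>(N - s) / 2 ^ d\<close> over the
  integers, so it grows exactly when \<open>2 ^ d\<close> divides \<open>N - s\<close>.\<close>

lemma visits_Suc:
  assumes "s < 2 ^ d"
  shows "visits (Suc N) d s = visits N d s + (if N mod 2 ^ d = s then 1 else 0)"
proof -
  have eq: "Suc N + 2 ^ d - 1 - s = Suc (N + 2 ^ d - 1 - s)" "Suc (N + 2 ^ d - 1 - s) = N + (2 ^ d - s)"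
    using assms by auto
  have "(N + (2 ^ d - s)) mod 2 ^ d = 0 \<longleftrightarrow> N mod 2 ^ d = s"
  proof -
    have "(N + (2 ^ d - s)) mod 2 ^ d = 0 \<longleftrightarrow> [N + (2 ^ d - s) = s + (2 ^ d - s)] (mod 2 ^ d)"
      using assms by (simp add: cong_def)
    also have "\<dots> \<longleftrightarrow> [N = s] (mod 2 ^ d)" by (rule cong_add_rcancel_nat)
    finally show ?thesis using assms by (simp add: cong_def)
  qed
  then show ?thesis unfolding visits_def eq(1) div_Suc by (simp only: eq(2)) simp
qed

text \<open>The earlier particles at this node are \<open>N mod 2 ^ d + i * 2 ^ d\<close> with
  \<open>i < N div 2 ^ d\<close>.\<close>

lemma visits_self: "visits N d (N mod 2 ^ d) = N div 2 ^ d"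
proof -
  have lt: "N mod 2 ^ d < 2 ^ d" by simp
  have "N + 2 ^ d - 1 - N mod 2 ^ d = (2 ^ d - 1) + N div 2 ^ d * 2 ^ d"
    using div_mult_mod_eq[of N "2 ^ d"] lt by linarith
  then have "visits N d (N mod 2 ^ d) = ((2 ^ d - 1) + N div 2 ^ d * 2 ^ d) div 2 ^ d"
    unfolding visits_def by (rule arg_cong)
  also have "\<dots> = N div 2 ^ d + (2 ^ d - 1) div 2 ^ d" by (subst div_mult_self1) simp_all
  finally show ?thesis by simp
qed

lemma mod_pow2_Suc:
  "(N::nat) mod 2 ^ Suc d = N mod 2 ^ d + (if odd (N div 2 ^ d) then 2 ^ d else 0)"
  using mod_mult2_eq[of N "2 ^ d" 2] by (auto simp: mult.commute odd_iff_mod_2_eq_one)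

text \<open>
  The counts of the network when particle \<open>N\<close> has passed the levels below \<open>d\<close> of the tree.
\<close>

definition tree_state :: "(nat \<Rightarrow> nat) \<Rightarrow> nat \<Rightarrow> nat \<Rightarrow> nat \<Rightarrow> nat \<Rightarrow> (vertex \<Rightarrow> nat) \<Rightarrow> bool" where
  "tree_state r \<sigma> k N d c \<longleftrightarrow> (\<forall>e<k. \<forall>s<2 ^ e.
     switch r \<sigma> c e s (odd (visits (if e < d then Suc N else N) e s)))"

section \<open>Passage through a single switch\<close>

locale switching =
  fixes r :: "nat \<Rightarrow> nat" and \<sigma> :: nat
  assumes pair: "(r (2 * n) = 1 \<and> r (2 * n + 1) = 2) \<or> (r (2 * n) = 2 \<and> r (2 * n + 1) = 1)"
    and ordered: "r n = \<sigma> \<Longrightarrow> r (2 * n) = 1"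
    and sigma: "\<sigma> = 1 \<or> \<sigma> = 2"
begin

text \<open>Block \<open>i\<close> contains both states, at places not before \<open>i\<close>;
  hence a switch cannot hold a particle forever.\<close>

lemma occurs: "\<exists>n\<ge>i. r n = \<sigma>"
  using pair[of i] sigma by (metis le_add1 mult_2 trans_le_add1)

end

locale tree = switching r \<sigma> for r :: "nat \<Rightarrow> nat" and \<sigma> :: nat +
  fixes r' :: "nat \<Rightarrow> nat" and m :: nat and k :: nat
  assumes m_pos: "m > 0" and m_le: "m \<le> 2 ^ k" and k_pos: "k > 0"
begin

abbreviation "T \<equiv> Target ` r' ` {..<m}"
abbreviation "\<delta> \<equiv> tree_edge r' m k \<sigma>"
abbreviation "nd \<equiv> node r' m k"
abbreviation run (infix "\<leadsto>" 50) where "p \<leadsto> q \<equiv> (step T \<delta> r)\<^sup>*\<^sup>* p q"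

lemma run1: "v \<notin> T \<Longrightarrow> (\<delta> v (r (c v)), c(v := Suc (c v))) \<leadsto> q \<Longrightarrow> (v, c) \<leadsto> q"
  by (rule converse_rtranclp_into_rtranclp) (auto simp: step_def)

lemma run_refl: "p = q \<Longrightarrow> p \<leadsto> q"
  by simp

text \<open>Block \<open>j\<close> of \<open>U\<close> visits \<open>X\<close> and \<open>Y\<close>
  once each, in either order, and both are in state \<open>r j\<close>, which returns the particle
  to \<open>U\<close>.\<close>

lemma switch_skip:
  assumes "c (U d s) = 2 * j" "c (X d s) = j" "c (Y d s) = j" "r j \<noteq> \<sigma>"
  shows "(U d s, c) \<leadsto> (U d s, c(U d s := 2 * Suc j, X d s := Suc j, Y d s := Suc j))"
proof -
  let ?c = "c(U d s := 2 * Suc j, X d s := Suc j, Y d s := Suc j)"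
  consider "r (2 * j) = 1" "r (Suc (2 * j)) = 2" | "r (2 * j) = 2" "r (Suc (2 * j)) = 1"
    using pair[of j] by auto
  then show ?thesis
  proof cases
    case 1
    show ?thesis
      apply (rule run1, force)
      apply (simp add: assms 1)
      apply (rule run1, force)
      apply (simp add: assms 1)
      apply (rule run1, force)
      apply (simp add: assms 1)
      apply (rule run1, force)
      apply (simp add: assms 1)
      apply (rule run_refl)
      apply (simp add: fun_eq_iff)
      done
  next
    case 2
    show ?thesis
      apply (rule run1, force)
      apply (simp add: assms 2)
      apply (rule run1, force)
      apply (simp add: assms 2)
      apply (rule run1, force)
      apply (simp add: assms 2)
      apply (rule run1, force)
      apply (simp add: assms 2)
      apply (rule run_refl)
      apply (simp add: fun_eq_iff)
      done
  qed
qed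

lemma switch_skips:
  assumes "c (U d s) = 2 * j" "c (X d s) = j" "c (Y d s) = j" "j \<le> i"
    and "\<And>l. j \<le> l \<Longrightarrow> l < i \<Longrightarrow> r l \<noteq> \<sigma>"
  shows "(U d s, c) \<leadsto> (U d s, c(U d s := 2 * i, X d s := i, Y d s := i))"
  using assms(4,5)
proof (induction i rule: dec_induct)
  case base
  have "c(U d s := 2 * j, X d s := j, Y d s := j) = c" using assms(1-3) by auto
  then show ?case by (simp del: fun_upd_apply)
next
  case (step i)
  let ?c = "c(U d s := 2 * i, X d s := i, Y d s := i)"
  have "?c(U d s := 2 * Suc i, X d s := Suc i, Y d s := Suc i) =
      c(U d s := 2 * Suc i, X d s := Suc i, Y d s := Suc i)"
    by (simp add: fun_eq_iff)
  moreover have "(U d s, ?c) \<leadsto>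
      (U d s, ?c(U d s := 2 * Suc i, X d s := Suc i, Y d s := Suc i))"
    by (rule switch_skip) (use step in auto)
  moreover have "(U d s, c) \<leadsto> (U d s, ?c)" using step.prems by (intro step.IH) simp
  ultimately show ?case by (simp only: rtranclp_trans)
qed

lemma switch_pass:
  assumes "switch r \<sigma> c d s b"
  shows "\<exists>c'. (U d s, c) \<leadsto> (nd (Suc d) (s + (if b then 2 ^ d else 0)), c') \<and>
           switch r \<sigma> c' d s (\<not> b) \<and> (\<forall>v. v \<notin> {U d s, X d s, Y d s} \<longrightarrow> c' v = c v)"
proof -
  define j where "j = c (Y d s)"
  show ?thesis
  proof (cases b)
    case True
    then have c: "c (U d s) = Suc (2 * j)" "c (X d s) = Suc j" "c (Y d s) = j" "r j = \<sigma>"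
      using assms by (auto simp: switch_def j_def)
    \<comment> \<open>As \<open>r j = \<sigma>\<close>, block \<open>j\<close> is \<open>12\<close>;
      its second entry leads to \<open>Y\<close>, whose state is still \<open>r j\<close>, so
      \<open>Y\<close> releases.\<close>
    then have r: "r (Suc (2 * j)) = 2" using pair[of j] ordered[of j] by auto
    have "(U d s, c) \<leadsto> (nd (Suc d) (s + 2 ^ d), c(U d s := 2 * Suc j, Y d s := Suc j))"
      apply (rule run1, force)
      apply (simp add: c r)
      apply (rule run1, force)
      apply (simp add: c r)
      done
    then show ?thesis using True c
      by (intro exI[of _ "c(U d s := 2 * Suc j, Y d s := Suc j)"]) (auto simp: switch_def)
  next
    case False
    then have c: "c (U d s) = 2 * j" "c (X d s) = j" "c (Y d s) = j"
      using assms by (auto simp: switch_def j_def)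
    \<comment> \<open>Block \<open>i\<close> is the first one from \<open>j\<close> on in which
      \<open>X\<close> and \<open>Y\<close> release; the blocks before it are skipped.\<close>
    define i where "i = (LEAST n. n \<ge> j \<and> r n = \<sigma>)"
    have i: "i \<ge> j" "r i = \<sigma>" using LeastI_ex[OF occurs[of j]] by (auto simp: i_def)
    have "r l \<noteq> \<sigma>" if "j \<le> l" "l < i" for l
      using not_less_Least[of l "\<lambda>n. n \<ge> j \<and> r n = \<sigma>"] that by (auto simp: i_def)
    with c i have skip: "(U d s, c) \<leadsto> (U d s, c(U d s := 2 * i, X d s := i, Y d s := i))"
      by (intro switch_skips) auto
    let ?c = "c(U d s := Suc (2 * i), X d s := Suc i, Y d s := i)"
    have r: "r (2 * i) = 1" using ordered i by simp
    have "(U d s, c(U d s := 2 * i, X d s := i, Y d s := i)) \<leadsto> (nd (Suc d) s, ?c)"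
      apply (rule run1, force)
      apply (simp add: r)
      apply (rule run1, force)
      apply (simp add: i)
      apply (rule run_refl)
      apply (simp add: fun_eq_iff)
      done
    with skip have "(U d s, c) \<leadsto> (nd (Suc d) s, ?c)" by (rule rtranclp_trans)
    then show ?thesis using False i by (intro exI[of _ ?c]) (auto simp: switch_def)
  qed
qed

section \<open>Descent through the tree\<close>

lemma tree_descend:
  assumes "tree_state r \<sigma> k N d c" "d < k"
  shows "\<exists>c'. (nd d (N mod 2 ^ d), c) \<leadsto> (nd (Suc d) (N mod 2 ^ Suc d), c') \<and>
           tree_state r \<sigma> k N (Suc d) c'"
proof -
  let ?s = "N mod 2 ^ d"
  \<comment> \<open>The parity of the number of earlier visits is binary digit \<open>d\<close> of
    \<open>N\<close>, which by \<open>mod_pow2_Suc\<close> selects the right child.\<close>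
  have "switch r \<sigma> c d ?s (odd (N div 2 ^ d))"
    using assms(1)[unfolded tree_state_def, rule_format, of d ?s] assms(2) visits_self[of N d]
    by simp
  from switch_pass[OF this] obtain c' where
    c': "(U d ?s, c) \<leadsto> (nd (Suc d) (N mod 2 ^ Suc d), c')"
      "switch r \<sigma> c' d ?s (\<not> odd (N div 2 ^ d))"
      "\<And>v. v \<notin> {U d ?s, X d ?s, Y d ?s} \<Longrightarrow> c' v = c v"
    unfolding mod_pow2_Suc by blast
  have "switch r \<sigma> c' e s (odd (visits (if e < Suc d then Suc N else N) e s))"
    if "e < k" "s < 2 ^ e" for e s
  proof (cases "e = d \<and> s = ?s")
    case True
    moreover have "visits (Suc N) d ?s = Suc (N div 2 ^ d)" by (simp add: visits_Suc visits_self)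
    ultimately show ?thesis using c'(2) by simp
  next
    case False
    have sw: "switch r \<sigma> c e s (odd (visits (if e < d then Suc N else N) e s))"
      using assms(1) that by (simp add: tree_state_def)
    have eq: "visits (if e < Suc d then Suc N else N) e s = visits (if e < d then Suc N else N) e s"
    proof (cases "e = d")
      case True
      then show ?thesis using False that(2) by (simp add: visits_Suc)
    qed simp
    show ?thesis unfolding eq
      by (rule switch_cong[OF sw]; rule c'(3)) (use False in simp_all)
  qed
  then have "tree_state r \<sigma> k N (Suc d) c'" by (simp add: tree_state_def)
  moreover have "nd d ?s = U d ?s" using assms(2) by (simp add: node_def)
  ultimately show ?thesis using c'(1) by auto
qed

lemma tree_pass:
  assumes "tree_state r \<sigma> k N 0 c"
  shows "\<exists>c'. (U 0 0, c) \<leadsto> (nd k (N mod 2 ^ k), c') \<and> tree_state r \<sigma> k (Suc N) 0 c'"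
proof -
  have levels: "\<exists>c'. (U 0 0, c) \<leadsto> (nd d (N mod 2 ^ d), c') \<and> tree_state r \<sigma> k N d c'" if "d \<le> k" for d
    using that
  proof (induction d)
    case 0
    then show ?case using assms k_pos by (auto simp: node_def)
  next
    case (Suc d)
    then obtain c' where c': "(U 0 0, c) \<leadsto> (nd d (N mod 2 ^ d), c')" "tree_state r \<sigma> k N d c'"
      by auto
    from Suc.prems have "d < k" by simp
    from tree_descend[OF c'(2) this] obtain c'' where
      "(nd d (N mod 2 ^ d), c') \<leadsto> (nd (Suc d) (N mod 2 ^ Suc d), c'')" "tree_state r \<sigma> k N (Suc d) c''"
      by blast
    then show ?case using rtranclp_trans[OF c'(1)] by blast
  qed
  \<comment> \<open>Once particle \<open>N\<close> has passed all \<open>k\<close> levels, every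
    switch is as it must be before particle \<open>Suc N\<close> enters.\<close>
  have "tree_state r \<sigma> k N k c' = tree_state r \<sigma> k (Suc N) 0 c'" for c'
    by (simp add: tree_state_def)
  then show ?thesis using levels[of k] by simp
qed

lemma tree_skip:
  assumes "tree_state r \<sigma> k N 0 c" "N \<le> N'" "\<And>i. N \<le> i \<Longrightarrow> i < N' \<Longrightarrow> m \<le> i mod 2 ^ k"
  shows "\<exists>c'. (U 0 0, c) \<leadsto> (U 0 0, c') \<and> tree_state r \<sigma> k N' 0 c'"
  using assms(2,3)
proof (induction N' rule: dec_induct)
  case base
  then show ?case using assms(1) by blast
next
  case (step N')
  then obtain c' where c': "(U 0 0, c) \<leadsto> (U 0 0, c')" "tree_state r \<sigma> k N' 0 c'"
    by auto
  have leaf: "nd k (N' mod 2 ^ k) = U 0 0"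
    using step.prems[of N'] step.hyps by (simp add: node_def not_less)
  from tree_pass[OF c'(2)] obtain c'' where
    "(U 0 0, c') \<leadsto> (U 0 0, c'')" "tree_state r \<sigma> k (Suc N') 0 c''"
    unfolding leaf by blast
  then show ?case using rtranclp_trans[OF c'(1)] by blast
qed

section \<open>Finiteness and reachability of targets\<close>

definition V :: "vertex set" where
  "V = T \<union> (\<Union>d<k. \<Union>s<2 ^ d. {U d s, X d s, Y d s})"

lemma nd_in_V: "d \<le> k \<Longrightarrow> s < 2 ^ d \<Longrightarrow> nd d s \<in> V"
  using k_pos by (auto simp: node_def V_def)

lemma edge_in_V:
  assumes "v \<in> V - T"
  shows "\<delta> v a \<in> V"
proof -
  from assms obtain d s where v: "v \<in> {U d s, X d s, Y d s}" "d < k" "s < 2 ^ d"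
    by (auto simp: V_def)
  then have "nd (Suc d) s \<in> V" "nd (Suc d) (s + 2 ^ d) \<in> V" by (auto intro!: nd_in_V)
  moreover have "{U d s, X d s, Y d s} \<subseteq> V" using v by (auto simp: V_def)
  ultimately show ?thesis using v(1) by auto
qed

definition edge (infix "\<rightarrow>" 50) where "v \<rightarrow> w \<longleftrightarrow> v \<in> V - T \<and> (\<exists>n. w = \<delta> v (r n))"

lemma edges:
  assumes "d < k" "s < 2 ^ d"
  shows "U d s \<rightarrow> X d s" "X d s \<rightarrow> nd (Suc d) s" "Y d s \<rightarrow> nd (Suc d) (s + 2 ^ d)"
proof -
  obtain n n' where "r n = 1" "r n' = \<sigma>" using pair[of 0] occurs[of 0] by blast
  then show "U d s \<rightarrow> X d s" "X d s \<rightarrow> nd (Suc d) s" "Y d s \<rightarrow> nd (Suc d) (s + 2 ^ d)"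
    using assms by (auto simp: edge_def V_def intro: exI[of _ n] exI[of _ n'])
qed

text \<open>Leaving every level through \<open>X\<close> keeps the index.\<close>

lemma node_reaches_leaf: "d \<le> k \<Longrightarrow> s < 2 ^ d \<Longrightarrow> edge\<^sup>*\<^sup>* (nd d s) (nd k s)"
proof (induction d rule: inc_induct)
  case (step d)
  have "edge\<^sup>*\<^sup>* (nd (Suc d) s) (nd k s)" using step by auto
  moreover have e: "U d s \<rightarrow> X d s" "X d s \<rightarrow> nd (Suc d) s" using step by (simp_all add: edges)
  ultimately have "edge\<^sup>*\<^sup>* (U d s) (nd k s)"
    by (intro converse_rtranclp_into_rtranclp[of edge, OF e(1)]
        converse_rtranclp_into_rtranclp[of edge, OF e(2)])
  then show ?case using step by (simp add: node_def[of _ _ _ d])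
qed simp

lemma node_reaches_target:
  assumes "d \<le> k" "s < 2 ^ d"
  shows "\<exists>t\<in>T. edge\<^sup>*\<^sup>* (nd d s) t"
proof (cases "s < m")
  case True
  with node_reaches_leaf[OF assms] show ?thesis by (auto simp: node_def[of _ _ _ k])
next
  case False
  then have root: "edge\<^sup>*\<^sup>* (nd d s) (nd 0 0)"
    using node_reaches_leaf[OF assms] k_pos by (simp add: node_def[of _ _ _ k] node_def[of _ _ _ 0])
  have "edge\<^sup>*\<^sup>* (nd 0 0) (Target (r' 0))"
    using node_reaches_leaf[of 0 0] m_pos by (simp add: node_def[of _ _ _ k])
  from rtranclp_trans[OF root this] show ?thesis using m_pos by blast
qed

lemma reaches_target:
  assumes "v \<in> V"
  shows "\<exists>t\<in>T. edge\<^sup>*\<^sup>* v t"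
proof (cases "v \<in> T")
  case False
  then obtain d s where v: "v = U d s \<or> v = X d s \<or> v = Y d s" and ds: "d < k" "s < 2 ^ d"
    using assms by (auto simp: V_def)
  have extend: "\<exists>t\<in>T. edge\<^sup>*\<^sup>* v t" if e: "v \<rightarrow> nd (Suc d) s'" and s': "s' < 2 ^ Suc d" for s'
  proof -
    obtain t where "t \<in> T" "edge\<^sup>*\<^sup>* (nd (Suc d) s') t"
      using node_reaches_target[of "Suc d" s'] ds(1) s' by auto
    then show ?thesis using converse_rtranclp_into_rtranclp[of edge, OF e] by blast
  qed
  from v show ?thesis
  proof (elim disjE)
    assume "v = U d s"
    then have "v = nd d s" using ds by (simp add: node_def)
    then show ?thesis using node_reaches_target[of d s] ds by simp
  next
    assume "v = X d s"
    then show ?thesis using extend[of s] edges(2)[OF ds] ds(2) by simp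
  next
    assume "v = Y d s"
    then show ?thesis using extend[of "s + 2 ^ d"] edges(3)[OF ds] ds(2) by simp
  qed
qed blast

section \<open>The hitting sequence of the tree\<close>

lemma models:
  assumes r: "periodic r" and r': "\<And>n. r' (n mod m) = r' n"
  shows "models r r'"
proof -
  define M where "M = (2::nat) ^ k"
  have M: "m \<le> M" "M > 0" using m_le by (auto simp: M_def)
  txt \<open>
    \<open>f n\<close> is the number of the particle that makes the \<open>n\<close>-th hit, and \<open>a n\<close> that of the first
    particle sent out after the previous hit.
  \<close>
  define f where "f n = M * (n div m) + n mod m" for n
  define a where "a n = (if n = 0 then 0 else Suc (f (n - 1)))" for n
  have lt: "n mod m < M" for n using M m_pos by (meson less_le_trans mod_less_divisor)
  have f_mod: "f n mod M = n mod m" for n using lt by (simp add: f_def)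
  have gap: "a n \<le> f n \<and> (\<forall>i. a n \<le> i \<and> i < f n \<longrightarrow> m \<le> i mod M)" for n
  proof (cases n)
    case (Suc l)
    show ?thesis
    proof (cases "Suc (l mod m) = m")
      case True
      have "Suc l div m = Suc (l div m)" "Suc l mod m = 0"
        using True by (simp_all add: div_Suc mod_Suc)
      then have fn: "f n = M * (l div m) + M" by (simp add: f_def Suc)
      have an: "a n = M * (l div m) + m" using True by (simp add: a_def f_def Suc)
      have "m \<le> i mod M" if "a n \<le> i" "i < f n" for i
      proof -
        define x where "x = i - M * (l div m)"
        have x: "i = M * (l div m) + x" "m \<le> x" "x < M"
          using that unfolding an fn x_def by linarith+
        then show ?thesis by simp
      qed
      then show ?thesis using an fn M by simp
    next
      case False
      then have "f n = Suc (f l)"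
        using m_pos by (simp add: f_def Suc div_Suc mod_Suc)
      then show ?thesis by (simp add: a_def Suc)
    qed
  qed (simp add: a_def f_def)
  let ?t = "\<lambda>n. Target (r' n)"
  have leaf: "nd k (f n mod 2 ^ k) = ?t n" for n
    using f_mod[of n] m_pos r' by (simp add: node_def M_def)
  show ?thesis
  proof (rule modelsI[where V = V and s = "U 0 0" and T = T and \<delta> = \<delta> and t = ?t
        and I = "\<lambda>n. tree_state r \<sigma> k (a n) 0" and f = "\<lambda>v. case v of Target x \<Rightarrow> x | _ \<Rightarrow> 0"])
    show "finite V" "T \<subseteq> V" "U 0 0 \<in> V" using k_pos by (auto simp: V_def)
    show "tree_state r \<sigma> k (a 0) 0 (\<lambda>_. 0)"
      by (simp add: tree_state_def a_def visits_0 switch_def)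
    show "?t n \<in> T" for n using r'[of n] m_pos by (intro imageI rev_image_eqI[of "n mod m"]) auto
    fix n c assume "tree_state r \<sigma> k (a n) 0 c"
    from tree_skip[OF this, of "f n"] gap[of n] obtain c1
      where c1: "(U 0 0, c) \<leadsto> (U 0 0, c1)" "tree_state r \<sigma> k (f n) 0 c1"
      unfolding M_def by blast
    from tree_pass[OF c1(2)] obtain c2
      where c2: "(U 0 0, c1) \<leadsto> (?t n, c2)" "tree_state r \<sigma> k (Suc (f n)) 0 c2"
      unfolding leaf by blast
    then show "\<exists>c'. (U 0 0, c) \<leadsto> (?t n, c') \<and> tree_state r \<sigma> k (a (Suc n)) 0 c'"
      using rtranclp_trans[OF c1(1)] by (auto simp: a_def)
  next
    show "\<exists>w\<in>T. (\<lambda>v w. v \<in> V - T \<and> (\<exists>n. w = \<delta> v (r n)))\<^sup>*\<^sup>* v w" if "v \<in> V" for v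
      using reaches_target[OF that] unfolding edge_def[abs_def] .
  qed (use r edge_in_V in \<open>auto simp: inj_on_def\<close>)
qed

end

lemma (in switching) universal:
  assumes "periodic r"
  shows "universal r"
  unfolding universal_def
proof (intro allI impI)
  fix r' assume "rotor_type r'"
  then obtain m where m: "m > 0" "\<And>n. r' (n + m) = r' n"
    by (auto simp: rotor_type_def periodic_def)
  \<comment> \<open>The period also serves as depth, since \<open>m \<le> 2 ^ m\<close>.\<close>
  interpret tree r \<sigma> r' m m
    by unfold_locales (use m(1) in \<open>auto simp: less_imp_le\<close>)
  show "models r r'" using assms period_mod[where f = r' and p = m, OF m(2)] by (intro models)
qed

section \<open>The releasing state from conditions (ii) and (iii)\<close>

theorem theorem8p4:
  fixes r :: "nat \<Rightarrow> nat"
  assumes "abba r"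
    and "[fundamental_period r = 0] (mod 4)"
    and "\<forall>a \<in> block21_positions r. \<forall>b \<in> block21_positions r.
           \<not> [\<lceil>real a / 2\<rceil> = int b] (mod int (fundamental_period r))"
    and "\<forall>a \<in> block21_positions r. \<forall>b \<in> block21_positions r. even a \<longleftrightarrow> even b"
  shows "universal r"
proof -
  have per: "periodic r" using assms(1) by (simp add: abba_def two_state_def rotor_type_def)
  have pair: "(r (2 * n) = 1 \<and> r (2 * n + 1) = 2) \<or> (r (2 * n) = 2 \<and> r (2 * n + 1) = 1)" for n
  proof -
    have "\<forall>k\<ge>1. block r k = (1, 2) \<or> block r k = (2, 1)"
      using assms(1) unfolding abba_def by (elim conjE)
    then have "block r (Suc n) = (1, 2) \<or> block r (Suc n) = (2, 1)"
      by (elim allE[of _ "Suc n"]) simp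
    then show ?thesis by (simp add: block_def)
  qed
  have pos: "Suc n \<in> block21_positions r \<longleftrightarrow> r (2 * n) = 2" for n
    using pair[of n] by (auto simp: block21_positions_def block_def)
  \<comment> \<open>In positions from 1, block \<open>l\<close> is at the ceiling of half the
    position of block \<open>n\<close>, so (ii) forbids both to be \<open>21\<close>.\<close>
  have half: False if "r (2 * n) = 2" "r (2 * l) = 2" "n = 2 * l \<or> n = Suc (2 * l)" for n l
  proof -
    have "\<lceil>real (Suc n) / 2\<rceil> = int (Suc l)"
      using that(3) by (auto simp: ceiling_eq_iff)
    then show False using assms(3) pos[of n] pos[of l] that by (metis cong_refl)
  qed
  have even_or_odd: "\<exists>\<sigma>\<in>{1, 2}. \<forall>n. r n = \<sigma> \<longrightarrow> r (2 * n) = 1"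
  proof (cases "\<exists>n. r (2 * n) = 2 \<and> even n")
    case True
    then obtain l where l: "r (2 * l) = 2" "even l" by blast
    have "r (2 * n) = 1" if "r n = 2" for n
    proof (rule ccontr)
      assume "r (2 * n) \<noteq> 1"
      then have n: "r (2 * n) = 2" using pair[of n] by auto
      then have "even n" using assms(4) pos[of n] pos[of l] l by (metis even_Suc)
      \<comment> \<open>For even \<open>n\<close>, the entry \<open>r n = 2\<close> opens block
        \<open>n div 2\<close>, which is thus \<open>21\<close>.\<close>
      then show False using half[of n "n div 2"] n that by auto
    qed
    then show ?thesis by auto
  next
    case False
    have "r (2 * n) = 1" if "r n = 1" for n
    proof (rule ccontr)
      assume "r (2 * n) \<noteq> 1"
      then have n: "r (2 * n) = 2" using pair[of n] by auto
      then obtain l where "n = Suc (2 * l)" using False by (metis oddE Suc_eq_plus1)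
      \<comment> \<open>For odd \<open>n\<close>, the entry \<open>r n = 1\<close> closes block
        \<open>l\<close>, which is thus \<open>21\<close>.\<close>
      then show False using half[of n l] n that pair[of l] by auto
    qed
    then show ?thesis by auto
  qed
  then obtain \<sigma> where "\<sigma> = 1 \<or> \<sigma> = 2" "\<And>n. r n = \<sigma> \<Longrightarrow> r (2 * n) = 1" by blast
  then interpret switching r \<sigma> using pair by unfold_locales
  show ?thesis using per by (rule universal)
qed

end
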